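(* Let $f$ be an endomorphism of $\{a,b\}^*$, where the alphabet is ordered by $a \prec b$, and assume $f$ is prolongable on $a$. Then the infinite word $f^\omega(a)$ is an infinite Lyndon word if and only if the following three conditions hold: (1) $f$ preserves the lexicographic order on finite words; (2) $f^\omega(a)$ is not periodic; (3) the word $f^3(a)$ is a prefix of a (finite) Lyndon word.
   Context: The lexicographic order $\prec$ on finite and infinite words over $\{a \prec b\}$: $u \prec v$ iff $u$ is a proper prefix of $v$ (when $u$ is finite), or $u = x\alpha y$, $v = x\beta z$ with letters $\alpha \prec \beta$. A non-empty finite word $w$ is a Lyndon word if $w \prec s$ for every non-empty proper suffix $s$ of $w$. An infinite word is an infinite Lyndon word if it has infinitely many prefixes that are (finite) Lyndon words (equivalently, it is strictly smaller than all its proper suffixes). An infinite word is periodic if it equals $u^\omega = uuu\cdots$ for some non-empty finite word $u$. A morphism $f$ (i.e. $f(uv)=f(u)f(v)$) is prolongable on $a$ if $f(a) = au$ for some word $u$ and $|f^n(a)| \to \infty$; then $f^\omega(a)$ denotes the unique infinite word having every $f^n(a)$ as a prefix. $f$ preserves the lexicographic order on finite words if for all finite words $u,v$, $u \prec v$ implies $f(u) \prec f(v)$. *)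

theory Defs
  imports Complex_Main "HOL-Library.Sublist" "HOL-Library.Stream"
begin

datatype letter = A | B

type_synonym word = "letter list"

type_synonym infword = "letter stream"

text \<open>
  \<^const>\<open>lexord\<close> makes every word smaller than its proper extensions; at the first difference
  the letters are compared by the given relation, here \<open>A\<close> below \<open>B\<close> only.
\<close>

definition lex_less :: "word \<Rightarrow> word \<Rightarrow> bool"  (infix "\<prec>" 50)
  where "u \<prec> v \<longleftrightarrow> (u, v) \<in> lexord {(A, B)}"

definition lyndon :: "word \<Rightarrow> bool"
  where "lyndon w \<longleftrightarrow> w \<noteq> [] \<and> (\<forall>s. s \<noteq> [] \<and> strict_suffix s w \<longrightarrow> w \<prec> s)"

definition prefix_of_infword :: "word \<Rightarrow> infword \<Rightarrow> bool"
  where "prefix_of_infword u w \<longleftrightarrow> (\<exists>v. w = u @- v)"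

definition infinite_lyndon :: "infword \<Rightarrow> bool"
  where "infinite_lyndon w \<longleftrightarrow> infinite {u. prefix_of_infword u w \<and> lyndon u}"

text \<open>For non-empty \<open>u\<close>, \<^term>\<open>cycle u\<close> is the infinite repetition of \<open>u\<close>.\<close>

definition periodic :: "infword \<Rightarrow> bool"
  where "periodic w \<longleftrightarrow> (\<exists>u. u \<noteq> [] \<and> w = cycle u)"

definition endomorphism :: "(word \<Rightarrow> word) \<Rightarrow> bool"
  where "endomorphism f \<longleftrightarrow> (\<forall>u v. f (u @ v) = f u @ f v)"

definition prolongable :: "(word \<Rightarrow> word) \<Rightarrow> letter \<Rightarrow> bool"
  where "prolongable f x \<longleftrightarrow>
    (\<exists>u. f [x] = x # u) \<and> filterlim (\<lambda>n. length ((f ^^ n) [x])) at_top sequentially"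

text \<open>
  The infinite word generated by \<open>f\<close> on \<open>x\<close>; meaningful when \<open>f\<close> is an endomorphism prolongable
  on \<open>x\<close>, see \<open>ex1_omega_iterate\<close> and \<open>prefix_omega_iterate\<close> below.
\<close>

definition omega_iterate :: "(word \<Rightarrow> word) \<Rightarrow> letter \<Rightarrow> infword"
  where "omega_iterate f x = (THE w. \<forall>n. prefix_of_infword ((f ^^ n) [x]) w)"

definition preserves_lex :: "(word \<Rightarrow> word) \<Rightarrow> bool"
  where "preserves_lex f \<longleftrightarrow> (\<forall>u v. u \<prec> v \<longrightarrow> f u \<prec> f v)"

lemma prefix_of_infword_iff:
  "prefix_of_infword u w \<longleftrightarrow> (\<forall>i < length u. w !! i = u ! i)"
proof
  assume "\<forall>i < length u. w !! i = u ! i"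
  then have "stake (length u) w = u"
    by (intro nth_equalityI) auto
  then show "prefix_of_infword u w"
    unfolding prefix_of_infword_def by (metis stake_sdrop)
qed (auto simp: prefix_of_infword_def)

lemma ex1_omega_iterate:
  assumes "endomorphism f" and "prolongable f x"
  shows "\<exists>!w. \<forall>n. prefix_of_infword ((f ^^ n) [x]) w"
proof -
  let ?p = "\<lambda>n. (f ^^ n) [x]"
  obtain u where u: "f [x] = [x] @ u"
    using assms(2) by (auto simp: prolongable_def)
  have app: "f (y @ z) = f y @ f z" for y z
    using assms(1) by (simp add: endomorphism_def)
  have step: "prefix (?p n) (?p (Suc n))" for n
  proof (induction n)
    case 0
    then show ?case by (simp add: u)
  next
    case (Suc n)
    then show ?case by (auto simp: prefix_def app)
  qed
  have mono: "prefix (?p m) (?p n)" if "m \<le> n" for m n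
    using that by (induction n rule: dec_induct) (blast intro: step prefix_order.trans)+
  have ex: "\<exists>n. i < length (?p n)" for i
  proof -
    have "\<forall>\<^sub>F n in sequentially. Suc i \<le> length (?p n)"
      using assms(2) unfolding prolongable_def filterlim_at_top by blast
    then show ?thesis
      by (meson Suc_le_lessD eventually_sequentially order_refl)
  qed
  have agree: "?p m ! i = ?p n ! i" if "i < length (?p m)" "i < length (?p n)" for m n i
    using that mono[of m n] mono[of n m] by (cases "m \<le> n") (auto simp: prefix_def nth_append)
  define w where "w = smap (\<lambda>i. ?p (SOME n. i < length (?p n)) ! i) nats"
  show ?thesis
  proof (rule ex1I)
    show "\<forall>n. prefix_of_infword (?p n) w"
      unfolding prefix_of_infword_iff w_def
      by (auto intro!: agree someI_ex[OF ex])
  next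
    fix v
    assume v: "\<forall>n. prefix_of_infword (?p n) v"
    have "v !! i = w !! i" for i
      using v someI_ex[OF ex[of i]] unfolding prefix_of_infword_iff w_def by simp
    then have "smap id v = w"
      by (subst smap_alt) simp
    then show "v = w"
      by (simp add: stream.map_id)
  qed
qed

lemma prefix_omega_iterate:
  assumes "endomorphism f" and "prolongable f x"
  shows "prefix_of_infword ((f ^^ n) [x]) (omega_iterate f x)"
  using theI'[OF ex1_omega_iterate[OF assms]] by (simp add: omega_iterate_def)

end

theory Submission
  imports Defs "HOL-Library.Infinite_Set"
begin

text \<open>
  Write \<open>\<omega>\<close> for the fixed point of \<open>f\<close>. The engine is a periodicity criterion: if \<open>s f(s)\<close> is a prefix
  of \<open>\<omega>\<close> for a non-empty \<open>s\<close>, then \<open>s\<close> and \<open>f(s)\<close> commute, and hence \<open>\<omega> = s s s \<dots>\<close>.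

  For necessity, let \<open>u = f(a)\<close> and \<open>v = f(b)\<close>; order preservation amounts to \<open>u v \<prec> v\<close>. If this fails,
  then either some suffix of \<open>\<omega>\<close> starting with \<open>v\<close> is smaller than \<open>\<omega>\<close>, or \<open>u v = v t\<close>. In the latter case
  the image of a factor \<open>b a\<close> excludes \<open>u \<prec> t\<close>, the image of the first \<open>a b\<close> excludes \<open>t \<prec> u\<close>,
  so \<open>u\<close> and \<open>v\<close> commute and \<open>\<omega>\<close> is periodic.

  For sufficiency, every suffix of \<open>\<omega>\<close> starts inside the image of a letter of \<open>\<omega>\<close>. Below \<open>|f\<^sup>3(a)|\<close> no
  suffix can become smaller than \<open>\<omega>\<close>. By the criterion, this is long enough to force that the suffixes starting
  inside the first \<open>f(a)\<close> are greater than \<open>\<omega>\<close>, and that no non-empty suffix of \<open>f(b)\<close> is a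
  prefix of \<open>\<omega>\<close>. The remaining suffixes are handled by induction on the starting position, since \<open>f\<close>
  preserves the order.
\<close>

subsection \<open>The lexicographic order on finite words\<close>

lemma lex_less_iff:
  "u \<prec> v \<longleftrightarrow> strict_prefix u v \<or> (\<exists>x p q. u = x @ A # p \<and> v = x @ B # q)"
proof -
  have "(\<exists>a z. v = u @ a # z) \<longleftrightarrow> strict_prefix u v"
    by (metis append_Nil2 append_self_conv neq_Nil_conv prefix_def strict_prefix_def)
  then show ?thesis
    unfolding lex_less_def lexord_def by auto
qed

lemma lex_less_irrefl: "\<not> u \<prec> u"
  unfolding lex_less_def by (simp add: lexord_irreflexive)

lemma lex_less_trans: "u \<prec> v \<Longrightarrow> v \<prec> x \<Longrightarrow> u \<prec> x"
  unfolding lex_less_def by (rule lexord_trans) (auto simp: trans_def)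

lemma lex_less_asym: "u \<prec> v \<Longrightarrow> \<not> v \<prec> u"
  using lex_less_irrefl lex_less_trans by blast

lemma lex_less_linear: "u \<prec> v \<or> u = v \<or> v \<prec> u"
  unfolding lex_less_def
  by (rule lexord_linear) (metis (full_types) insert_iff letter.exhaust)

lemma lex_less_append_left: "u \<prec> v \<Longrightarrow> x @ u \<prec> x @ v"
  unfolding lex_less_def by (rule lexord_append_leftI)

lemma lex_less_append_right: "u \<prec> v \<Longrightarrow> u \<prec> v @ x"
  unfolding lex_less_iff by (auto simp: strict_prefix_def prefix_def)

lemma lex_less_long:
  assumes "u \<prec> v" and "length v \<le> length u"
  obtains x p q where "u = x @ A # p" and "v = x @ B # q"
proof -
  have "\<not> strict_prefix u v"
    using assms(2) prefix_length_less by fastforce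
  with assms(1) that show thesis
    unfolding lex_less_iff by blast
qed

lemma lex_less_nth:
  assumes "d < length u" "d < length v" "\<And>k. k < d \<Longrightarrow> u ! k = v ! k" "u ! d = A" "v ! d = B"
  shows "u \<prec> v"
proof -
  have "take d u = take d v"
    using assms by (intro nth_equalityI) auto
  then show ?thesis
    unfolding lex_less_iff using id_take_nth_drop[OF assms(1)] id_take_nth_drop[OF assms(2)] assms(4,5)
    by metis
qed

subsection \<open>Infinite words\<close>

text \<open>Infinite words differ only through a mismatch; locating it by position reduces suffixes
  to index arithmetic.\<close>

definition inf_less :: "infword \<Rightarrow> infword \<Rightarrow> bool"  (infix "\<prec>\<^sub>\<omega>" 50)
  where "x \<prec>\<^sub>\<omega> y \<longleftrightarrow> (\<exists>d. (\<forall>k<d. x !! k = y !! k) \<and> x !! d = A \<and> y !! d = B)"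

lemma stream_eqI: "(\<And>i. x !! i = y !! i) \<Longrightarrow> x = y"
  by (metis smap_alt stream.map_id0 id_apply)

lemma inf_less_linear: "x \<prec>\<^sub>\<omega> y \<or> x = y \<or> y \<prec>\<^sub>\<omega> x"
proof (cases "x = y")
  case False
  then obtain i where "x !! i \<noteq> y !! i"
    using stream_eqI by blast
  define d where "d = (LEAST i. x !! i \<noteq> y !! i)"
  have "x !! d \<noteq> y !! d" "\<forall>k<d. x !! k = y !! k"
    unfolding d_def using LeastI[of "\<lambda>i. x !! i \<noteq> y !! i", OF \<open>x !! i \<noteq> y !! i\<close>] not_less_Least
    by blast+
  then show ?thesis
    unfolding inf_less_def by (metis (full_types) letter.exhaust)
qed simp

lemma inf_less_asym: "x \<prec>\<^sub>\<omega> y \<Longrightarrow> \<not> y \<prec>\<^sub>\<omega> x"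
  unfolding inf_less_def by (metis letter.distinct(1) linorder_neqE_nat)

lemma inf_less_trans:
  assumes "x \<prec>\<^sub>\<omega> y" and "y \<prec>\<^sub>\<omega> z"
  shows "x \<prec>\<^sub>\<omega> z"
proof -
  obtain d e where "\<forall>k<d. x !! k = y !! k" "x !! d = A" "y !! d = B"
    and "\<forall>k<e. y !! k = z !! k" "y !! e = A" "z !! e = B"
    using assms unfolding inf_less_def by blast
  then show ?thesis
    unfolding inf_less_def
    by (intro exI[of _ "min d e"]) (metis letter.distinct(1) linorder_neqE_nat min.absorb3 min.absorb4
        min_less_iff_conj)
qed

lemma inf_less_append: "x \<prec>\<^sub>\<omega> y \<Longrightarrow> u @- x \<prec>\<^sub>\<omega> u @- y"
proof -
  assume "x \<prec>\<^sub>\<omega> y"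
  then obtain d where "\<forall>k<d. x !! k = y !! k" "x !! d = A" "y !! d = B"
    unfolding inf_less_def by blast
  then show ?thesis
    unfolding inf_less_def by (intro exI[of _ "length u + d"]) (auto simp: shift_snth)
qed

lemma inf_less_prefix:
  assumes "prefix_of_infword (r @ [A]) x" and "prefix_of_infword (r @ [B]) y"
  shows "x \<prec>\<^sub>\<omega> y"
  using assms unfolding inf_less_def prefix_of_infword_iff
  by (intro exI[of _ "length r"]) (auto simp: nth_append less_Suc_eq)

lemma prefix_of_infword_stake: "prefix_of_infword u w \<longleftrightarrow> u = stake (length u) w"
  unfolding prefix_of_infword_iff by (metis length_stake nth_equalityI stake_nth)

lemma prefix_of_infword_eq:
  "prefix_of_infword u w \<Longrightarrow> prefix_of_infword v w \<Longrightarrow> length u = length v \<Longrightarrow> u = v"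
  unfolding prefix_of_infword_stake by simp

lemma prefix_of_infword_comparable:
  assumes "prefix_of_infword u w" "prefix_of_infword v w" "length u \<le> length v"
  shows "prefix u v"
proof -
  have "u = take (length u) v"
    using assms unfolding prefix_of_infword_stake by (metis min.absorb1 take_stake)
  then show ?thesis
    by (metis take_is_prefix)
qed

lemma prefix_of_infword_prefix: "prefix u v \<Longrightarrow> prefix_of_infword v w \<Longrightarrow> prefix_of_infword u w"
  unfolding prefix_of_infword_def prefix_def by force

lemma prefix_of_infword_appendD: "prefix_of_infword (u @ v) w \<Longrightarrow> prefix_of_infword u w"
  by (rule prefix_of_infword_prefix) auto

lemma prefix_of_infword_sdrop:
  "prefix_of_infword (u @ v) w \<Longrightarrow> prefix_of_infword v (sdrop (length u) w)"
  unfolding prefix_of_infword_def by (auto simp: sdrop_shift)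

lemma cycle_unique:
  assumes "s \<noteq> []" "x = s @- x"
  shows "x = cycle s"
proof (rule stream_eqI)
  fix i
  show "x !! i = cycle s !! i"
  proof (induction i rule: less_induct)
    case (less i)
    then show ?case
      using assms cycle_decomp[OF assms(1)]
      by (metis diff_less length_greater_0_conv not_less order_less_le_trans shift_snth_ge
          shift_snth_less)
  qed
qed

lemma periodic_sdrop:
  assumes "0 < i" "sdrop i w = w"
  shows "periodic w"
  unfolding periodic_def
  using assms cycle_unique[of "stake i w" w] by (metis length_greater_0_conv length_stake stake_sdrop)

subsection \<open>Infinite Lyndon words\<close>

text \<open>The descent makes \<open>drop i l\<close> smaller than \<open>l\<close>; for
  \<open>i = 0\<close> the two letter conditions clash.\<close>

lemma lyndon_nth:
  assumes "lyndon l" "i + d < length l" "\<And>k. k < d \<Longrightarrow> l ! k = l ! (i + k)" "l ! d = B" "l ! (i + d) = A"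
  shows False
proof (cases "i = 0")
  case False
  have "drop i l \<prec> l"
    using assms by (intro lex_less_nth[of d]) auto
  moreover have "l \<prec> drop i l"
    using assms(1,2) False unfolding lyndon_def
    by (metis add_lessD1 append_take_drop_id drop_eq_Nil length_drop diff_less bot_nat_0.not_eq_extremum
        linorder_not_less order_less_irrefl strict_suffix_def suffix_drop order_le_less_trans le0)
  ultimately show False
    using lex_less_asym by blast
qed (use assms in auto)

text \<open>The mismatch has to fall inside the first \<open>n\<close> letters: otherwise the suffix
  of \<open>stake n w\<close> is a prefix of it and hence smaller.\<close>

lemma lyndon_stakeI:
  assumes "0 < n"
    and "\<And>i. 0 < i \<Longrightarrow> i < n \<Longrightarrow>
      \<exists>d. i + d < n \<and> (\<forall>k<d. w !! k = w !! (i + k)) \<and> w !! d = A \<and> w !! (i + d) = B"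
  shows "lyndon (stake n w)"
  unfolding lyndon_def
proof (intro conjI allI impI)
  show "stake n w \<noteq> []"
    using assms(1) by simp
  fix s
  assume s: "s \<noteq> [] \<and> strict_suffix s (stake n w)"
  then obtain z where z: "stake n w = z @ s" "z \<noteq> []"
    unfolding strict_suffix_def suffix_def by auto
  define i where "i = length z"
  have "length z + length s = n"
    by (metis z(1) length_append length_stake)
  then have i: "0 < i" "i < n" "s = drop i (stake n w)"
    using s z unfolding i_def by auto
  from assms(2)[OF i(1,2)] obtain d where
    "i + d < n" "\<forall>k<d. w !! k = w !! (i + k)" "w !! d = A" "w !! (i + d) = B"
    by blast
  then show "stake n w \<prec> s"
    unfolding i(3) by (intro lex_less_nth[of d]) auto
qed

lemma infinite_prefixes_iff:
  "infinite {u. prefix_of_infword u w \<and> Q u} \<longleftrightarrow> (\<forall>N. \<exists>n>N. Q (stake n w))"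
proof -
  have eq: "{u. prefix_of_infword u w \<and> Q u} = (\<lambda>n. stake n w) ` {n. Q (stake n w)}"
    by (auto simp: prefix_of_infword_stake image_iff)
  have "inj_on (\<lambda>n. stake n w) {n. Q (stake n w)}"
    by (rule inj_onI) (metis length_stake)
  then show ?thesis
    by (simp add: eq finite_image_iff infinite_nat_iff_unbounded)
qed

text \<open>Let \<open>E\<close> be the largest position at which one of the suffixes at
  \<open>1..N\<close> first exceeds \<open>w\<close>. The prefix ending at \<open>E\<close> is
  Lyndon and longer than \<open>M\<close>.\<close>

lemma infinite_lyndonI:
  assumes "\<And>i. 0 < i \<Longrightarrow> w \<prec>\<^sub>\<omega> sdrop i w"
  shows "infinite_lyndon w"
  unfolding infinite_lyndon_def infinite_prefixes_iff
proof
  fix M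
  let ?D = "\<lambda>i d. (\<forall>k<d. w !! k = w !! (i + k)) \<and> w !! d = A \<and> w !! (i + d) = B"
  have "\<exists>d. ?D i d" if "0 < i" for i
    using assms[OF that] unfolding inf_less_def by (simp add: sdrop_snth)
  then obtain e where e: "?D i (e i)" if "0 < i" for i
    by metis
  define N where "N = Suc M"
  define E where "E = Max ((\<lambda>i. i + e i) ` {1..N})"
  have fin: "finite ((\<lambda>i. i + e i) ` {1..N})" "(\<lambda>i. i + e i) ` {1..N} \<noteq> {}"
    by (auto simp: N_def)
  have E: "i + e i \<le> E" if "0 < i" "i \<le> N" for i
    unfolding E_def using that by (intro Max_ge[OF fin(1)]) auto
  have "E \<in> (\<lambda>i. i + e i) ` {1..N}"
    unfolding E_def by (rule Max_in[OF fin])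
  then obtain i0 where "E = i0 + e i0" "i0 \<in> {1..N}"
    by (rule imageE)
  then have i0: "0 < i0" "i0 \<le> N" "E = i0 + e i0"
    by auto
  have "N \<le> E"
    using E[of N] by (simp add: N_def)
  \<comment> \<open>A suffix starting inside the stretch where the suffix at \<open>i0\<close> agrees with \<open>w\<close> exceeds \<open>w\<close> no
    later than the end of that stretch.\<close>
  have later: "\<exists>d. j + d \<le> E \<and> ?D j d" if j: "N < j" "j \<le> E" for j
  proof (cases "j + e j \<le> E")
    case True
    then show ?thesis using e[of j] j by auto
  next
    case False
    \<comment> \<open>At position \<open>E\<close> the suffix at \<open>j\<close> still agrees with
      \<open>w\<close>, so \<open>w\<close> has \<open>B\<close> at \<open>d\<close>. The suffix at
      \<open>i0\<close> has its mismatch there, so \<open>w\<close> has \<open>A\<close> at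
      \<open>e i0\<close>. Hence the suffix at \<open>j - i0\<close> would fall below
      \<open>w\<close> at offset \<open>d\<close>.\<close>
    define d where "d = E - j"
    have d: "j + d = E" "d < e j" "(j - i0) + d = e i0"
      using False j i0 by (auto simp: d_def)
    have D0: "?D i0 (e i0)" and Dj: "?D j (e j)"
      using e i0 j by auto
    have "w !! E = B" "w !! e i0 = A"
      using D0 i0(3) by auto
    have "w !! d = B"
      using Dj d \<open>w !! E = B\<close> by metis
    have "w !! k = w !! ((j - i0) + k)" if "k < d" for k
    proof -
      have "w !! k = w !! (j + k)"
        using Dj that d by auto
      also have "j + k = i0 + ((j - i0) + k)"
        using j i0 by simp
      also have "w !! \<dots> = w !! ((j - i0) + k)"
        using D0 that d by (metis nat_add_left_cancel_less)
      finally show ?thesis .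
    qed
    moreover have "0 < j - i0"
      using j i0 by simp
    ultimately have "sdrop (j - i0) w \<prec>\<^sub>\<omega> w"
      unfolding inf_less_def using \<open>w !! d = B\<close> \<open>w !! e i0 = A\<close> d(3)
      by (intro exI[of _ d]) (simp add: sdrop_snth)
    then show ?thesis
      using assms[OF \<open>0 < j - i0\<close>] inf_less_asym by blast
  qed
  have "lyndon (stake (Suc E) w)"
  proof (rule lyndon_stakeI)
    fix i
    assume i: "0 < i" "i < Suc E"
    show "\<exists>d. i + d < Suc E \<and> ?D i d"
    proof (cases "i \<le> N")
      case True
      then show ?thesis using E[OF i(1)] e[OF i(1)] by (auto simp: less_Suc_eq_le)
    next
      case False
      then show ?thesis using later[of i] i by (auto simp: less_Suc_eq_le)
    qed
  qed simp
  then show "\<exists>n>M. lyndon (stake n w)"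
    using \<open>N \<le> E\<close> N_def by (intro exI[of _ "Suc E"]) auto
qed

text \<open>If \<open>w\<close> equals its suffix at \<open>i\<close>, a Lyndon prefix longer than
  \<open>i\<close> has a border that is both smaller and larger than itself. If that suffix is
  smaller, a Lyndon prefix reaching past the mismatch contains the descent.\<close>

lemma infinite_lyndonD:
  assumes "infinite_lyndon w" "0 < i"
  shows "w \<prec>\<^sub>\<omega> sdrop i w"
proof -
  have long: "\<exists>n>N. lyndon (stake n w)" for N
    using assms(1) unfolding infinite_lyndon_def infinite_prefixes_iff by blast
  consider "w \<prec>\<^sub>\<omega> sdrop i w" | "w = sdrop i w" | "sdrop i w \<prec>\<^sub>\<omega> w"
    using inf_less_linear by blast
  then show ?thesis
  proof cases
    case 2
    obtain n where n: "i < n" "lyndon (stake n w)"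
      using long by blast
    have eq: "drop i (stake n w) = stake (n - i) w"
      using 2 by (simp add: drop_stake)
    have "strict_prefix (stake (n - i) w) (stake n w)"
      using n(1) assms(2)
      by (metis add_diff_inverse_nat diff_less length_stake less_le_trans not_less order_less_imp_le
          prefix_of_infword_comparable prefix_of_infword_stake strict_prefix_def diff_le_self
          less_imp_neq not_less_zero)
    then have "stake (n - i) w \<prec> stake n w"
      unfolding lex_less_iff by blast
    moreover have "stake n w \<prec> stake (n - i) w"
    proof -
      have "strict_suffix (stake (n - i) w) (stake n w)"
        unfolding eq[symmetric] strict_suffix_def
        by (metis assms(2) diff_less eq length_stake less_imp_neq n(1) suffix_drop less_trans)
      then show ?thesis
        using n unfolding lyndon_def by auto
    qed
    ultimately show ?thesis
      using lex_less_asym by blast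
  next
    case 3
    then obtain d where d: "\<forall>k<d. w !! (i + k) = w !! k" "w !! (i + d) = A" "w !! d = B"
      unfolding inf_less_def by (auto simp: sdrop_snth)
    obtain n where n: "i + d < n" "lyndon (stake n w)"
      using long by blast
    show ?thesis
      using lyndon_nth[OF n(2), of i d] n(1) d by simp
  qed
qed


subsection \<open>Fixed points of prolongable endomorphisms\<close>

lemma prefix_of_infword_mismatch:
  assumes "\<not> prefix_of_infword y w"
  obtains r c t c' where "y = r @ c # t" "prefix_of_infword (r @ [c']) w" "c \<noteq> c'"
proof -
  let ?P = "\<lambda>i. i < length y \<and> w !! i \<noteq> y ! i"
  obtain i where "?P i"
    using assms unfolding prefix_of_infword_iff by blast
  define d where "d = (LEAST i. ?P i)"
  have d: "?P d" "\<And>k. k < d \<Longrightarrow> \<not> ?P k"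
    unfolding d_def using LeastI[of ?P, OF \<open>?P i\<close>] not_less_Least by blast+
  have "y = take d y @ y ! d # drop (Suc d) y"
    using d(1) id_take_nth_drop by blast
  moreover have "prefix_of_infword (take d y @ [w !! d]) w"
    unfolding prefix_of_infword_iff using d by (auto simp: nth_append less_Suc_eq)
  ultimately show thesis
    using that d(1) by metis
qed

lemma prefix_of_infword_sdropD:
  assumes "prefix_of_infword u w" "prefix_of_infword v (sdrop (length u) w)"
  shows "prefix_of_infword (u @ v) w"
proof -
  obtain z where "sdrop (length u) w = v @- z"
    using assms(2) unfolding prefix_of_infword_def by blast
  then have "w = (u @ v) @- z"
    using assms(1) stake_sdrop[of "length u" w] unfolding prefix_of_infword_stake by simp
  then show ?thesis
    unfolding prefix_of_infword_def by blast
qed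

lemma prefix_of_infword_stakeI: "prefix_of_infword (stake n w) w"
  by (simp add: prefix_of_infword_stake)

lemma prefix_of_power:
  assumes "x = s @- x"
  shows "prefix_of_infword (concat (replicate m s)) x"
proof (induction m)
  case (Suc m)
  then show ?case
    using assms unfolding prefix_of_infword_def
    by (metis concat.simps(2) replicate_Suc shift_append)
qed (simp add: prefix_of_infword_def)

lemma prefix_of_cycle:
  assumes "s \<noteq> []"
  shows "prefix_of_infword x (cycle s) \<longleftrightarrow> (\<exists>m. prefix x (concat (replicate m s)))"
proof -
  have pow: "prefix_of_infword (concat (replicate m s)) (cycle s)" for m
    by (rule prefix_of_power) (rule cycle_decomp[OF assms])
  have len: "m \<le> length (concat (replicate m s))" for m
    using assms by (simp add: length_concat sum_list_replicate Suc_le_eq)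
  show ?thesis
    using pow len prefix_of_infword_comparable prefix_of_infword_prefix by metis
qed

locale prolongable_endomorphism =
  fixes f :: "word \<Rightarrow> word"
  assumes endo: "endomorphism f" and prolong: "prolongable f A"
begin

abbreviation omega :: infword  ("\<omega>")
  where "\<omega> \<equiv> omega_iterate f A"

lemma image_append: "f (x @ y) = f x @ f y"
  using endo by (simp add: endomorphism_def)

lemma image_Nil [simp]: "f [] = []"
  using image_append[of "[]" "[]"] by simp

lemma image_Cons: "f (c # x) = f [c] @ f x"
  using image_append[of "[c]" x] by simp

lemma image_concat_replicate: "f (concat (replicate m s)) = concat (replicate m (f s))"
  by (induction m) (auto simp: image_append)

lemma image_prefix: "prefix x y \<Longrightarrow> prefix (f x) (f y)"
  by (auto simp: prefix_def image_append)

lemma image_A: obtains u where "f [A] = A # u"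
  using prolong unfolding prolongable_def by blast

lemma iterate_long: obtains n where "N \<le> length ((f ^^ n) [A])"
proof -
  have "\<forall>\<^sub>F n in sequentially. N \<le> length ((f ^^ n) [A])"
    using prolong unfolding prolongable_def filterlim_at_top by blast
  then show thesis
    using that by (meson eventually_sequentially order_refl)
qed

lemma length_image_A: "2 \<le> length (f [A])"
proof (rule ccontr)
  assume *: "\<not> 2 \<le> length (f [A])"
  obtain u where u: "f [A] = A # u"
    by (rule image_A)
  then have "f [A] = [A]"
    using * by (cases u) auto
  then have "(f ^^ n) [A] = [A]" for n
    by (induction n) auto
  then show False
    using iterate_long[of 2] by auto
qed

text \<open>A prefix lies in some iterate and its image in the next one. This is the fixed point
  property of \<omega>, in terms of prefixes.\<close>

lemma omega_prefix_image:
  assumes "prefix_of_infword p \<omega>"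
  shows "prefix_of_infword (f p) \<omega>"
proof -
  obtain n where "length p \<le> length ((f ^^ n) [A])"
    by (rule iterate_long)
  then have "prefix p ((f ^^ n) [A])"
    using assms prefix_omega_iterate[OF endo prolong] prefix_of_infword_comparable by blast
  then have "prefix (f p) ((f ^^ Suc n) [A])"
    by (simp add: image_prefix)
  then show ?thesis
    using prefix_omega_iterate[OF endo prolong] prefix_of_infword_prefix by blast
qed

lemma omega_prefix_A: "prefix_of_infword [A] \<omega>"
  using prefix_omega_iterate[OF endo prolong, of 0] by simp

lemma omega_0: "\<omega> !! 0 = A"
  using omega_prefix_A by (simp add: prefix_of_infword_iff)

lemma omega_eqI: "(\<And>n. prefix_of_infword ((f ^^ n) [A]) x) \<Longrightarrow> \<omega> = x"
  using ex1_omega_iterate[OF endo prolong] prefix_omega_iterate[OF endo prolong] by blast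

text \<open>If \<open>s\<close> and \<open>f s\<close> commute, the set of prefixes of \<open>s s s \<dots>\<close> is closed under \<open>f\<close>.\<close>

lemma periodic_if_commute:
  assumes s: "s = A # s'" and comm: "s @ f s = f s @ s"
  shows "periodic \<omega>"
proof -
  have ne: "s \<noteq> []"
    using s by simp
  \<comment> \<open>By commutation this word solves \<open>x = s @- x\<close>, so it is
    \<open>cycle s\<close>; hence all powers of \<open>f s\<close> are prefixes of
    \<open>cycle s\<close>.\<close>
  have "f s @- cycle s = s @- (f s @- cycle s)"
    by (metis comm cycle_decomp[OF ne] shift_append)
  then have fs: "f s @- cycle s = cycle s"
    by (rule cycle_unique[OF ne])
  have "prefix_of_infword (concat (replicate m (f s))) (cycle s)" for m
    by (rule prefix_of_power) (rule fs[symmetric])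
  then have closed: "prefix_of_infword (f x) (cycle s)" if "prefix_of_infword x (cycle s)" for x
    using that unfolding prefix_of_cycle[OF ne, of x]
    by (metis image_concat_replicate image_prefix prefix_of_infword_prefix)
  have "prefix_of_infword ((f ^^ n) [A]) (cycle s)" for n
  proof (induction n)
    case 0
    show ?case
      using cycle_decomp[OF ne] s unfolding prefix_of_infword_def
      by (metis append_Cons append_Nil funpow_0 shift_append)
  qed (simp add: closed)
  then show ?thesis
    using ne omega_eqI unfolding periodic_def by blast
qed

lemma length_image_ge:
  assumes "f [B] \<noteq> []"
  shows "length x \<le> length (f x)"
proof (induction x)
  case (Cons c x)
  have "f [c] \<noteq> []"
    using assms image_A by (cases c) fastforce+
  then show ?case
    using Cons by (cases "f [c]") (auto simp: image_Cons[of c x])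
qed simp

text \<open>Here \<open>s\<close> is a prefix of \<open>f s\<close>, so \<open>s @ s\<close> is a
  prefix of \<omega>. Its image starts with \<open>f s @ s\<close>, which has the length of
  \<open>s @ f s\<close> and therefore equals it.\<close>

lemma periodic_if_prefix:
  assumes ne: "f [B] \<noteq> []" "s \<noteq> []" and pre: "prefix_of_infword (s @ f s) \<omega>"
  shows "periodic \<omega>"
proof -
  have s: "prefix_of_infword s \<omega>"
    using pre by (rule prefix_of_infword_appendD)
  have "prefix s (f s)"
    using s omega_prefix_image[OF s] length_image_ge[OF ne(1)] prefix_of_infword_comparable by blast
  then have "prefix (s @ s) (s @ f s)"
    by simp
  then have "prefix_of_infword (f (s @ s)) \<omega>"
    using pre omega_prefix_image prefix_of_infword_prefix by blast
  then have "prefix_of_infword (f s @ s) \<omega>"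
    using \<open>prefix s (f s)\<close> prefix_of_infword_prefix[of "f s @ s" "f s @ f s"]
    by (simp add: image_append)
  then have "s @ f s = f s @ s"
    using prefix_of_infword_eq[OF pre] by simp
  moreover obtain s' where "s = A # s'"
    using s omega_0 ne(2) unfolding prefix_of_infword_iff
    by (metis length_greater_0_conv list.exhaust nth_Cons_0)
  ultimately show ?thesis
    using periodic_if_commute by blast
qed

text \<open>An image \<open>f [A]\<close> without \<open>B\<close> would commute with
  \<open>[A]\<close> and make \<omega> periodic.\<close>

lemma first_block:
  assumes "\<not> periodic \<omega>"
  obtains n where "0 < n" "prefix (replicate n A @ [B]) (f [A])"
proof -
  have all_A: "x = replicate (length x) A" if "B \<notin> set x" for x
    using that by (intro replicate_eqI) (metis (full_types) letter.exhaust)+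
  have "B \<in> set (f [A])"
  proof (rule ccontr)
    assume "B \<notin> set (f [A])"
    then obtain k where k: "f [A] = replicate k A"
      using all_A by blast
    have "[A] @ f [A] = f [A] @ [A]"
      by (simp add: k replicate_append_same)
    then show False
      using assms periodic_if_commute[of "[A]"] by simp
  qed
  then obtain x z where x: "f [A] = x @ B # z" "B \<notin> set x"
    using split_list_first by metis
  have "x \<noteq> []"
    using x(1) image_A by (metis append_Nil letter.distinct(1) list.inject)
  then show thesis
    using that[of "length x"] all_A[OF x(2)] x(1)
    by (metis append.assoc append_Cons append_Nil length_greater_0_conv prefixI)
qed

text \<open>The hypothesis extends to \<open>f (A # g) \<prec> f [B]\<close> for every
  \<open>g\<close>: a further \<open>A\<close> only prepends \<open>f [A]\<close>, and after
  \<open>A # B\<close> the mismatch already lies inside \<open>f [A] @ f [B]\<close>.\<close>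

lemma preserves_lexI:
  assumes "f [A] @ f [B] \<prec> f [B]"
  shows "preserves_lex f"
proof -
  let ?u = "f [A]" and ?v = "f [B]"
  have v: "?v \<noteq> []"
    using assms unfolding lex_less_iff by auto
  have below: "f (A # g) \<prec> ?v" for g
  proof (induction g)
    case Nil
    have "?u \<prec> ?u @ ?v"
      using v unfolding lex_less_iff by (simp add: strict_prefix_def)
    then show ?case
      using assms lex_less_trans by blast
  next
    case (Cons c g)
    show ?case
    proof (cases c)
      case A
      then show ?thesis
        using Cons lex_less_append_left lex_less_trans assms image_Cons[of A "A # g"] by metis
    next
      case B
      obtain x p q where "?u @ ?v = x @ A # p" "?v = x @ B # q"
        using lex_less_long[OF assms] by auto
      then have "f (A # B # g) = x @ A # (p @ f g)"
        by (metis append.assoc append_Cons image_Cons)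
      then show ?thesis
        unfolding lex_less_iff using \<open>?v = x @ B # q\<close> B by blast
    qed
  qed
  show ?thesis
    unfolding preserves_lex_def
  proof (intro allI impI)
    fix y z :: word
    assume "y \<prec> z"
    then consider "strict_prefix y z" | x p q where "y = x @ A # p" "z = x @ B # q"
      unfolding lex_less_iff by blast
    then show "f y \<prec> f z"
    proof cases
      case 1
      then obtain c t where z: "z = y @ c # t"
        by (rule strict_prefixE')
      have "f [c] \<noteq> []"
        using v image_A by (cases c) fastforce+
      then have "strict_prefix (f y) (f z)"
        by (simp add: z image_append image_Cons[of c t] strict_prefix_def)
      then show ?thesis
        by (simp add: lex_less_iff)
    next
      case 2
      have "f (A # p) \<prec> f (B # q)"
        using below lex_less_append_right image_Cons[of B q] by metis
      then show ?thesis
        by (simp add: 2 image_append lex_less_append_left)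
    qed
  qed
qed

subsection \<open>Necessity\<close>

lemma image_replicate_shift:
  assumes "f [A] @ v = v @ t" "0 < n"
  shows "\<exists>r. f (replicate n A) @ v = v @ t @ r"
  using assms(2)
proof (induction n rule: nat_induct_non_zero)
  case 1
  then show ?case
    using assms(1) by simp
next
  case (Suc n)
  then obtain r where "f (replicate n A) @ v = v @ t @ r"
    by blast
  then have "f (replicate (Suc n) A) @ v = v @ t @ t @ r"
    using assms(1) image_Cons[of A "replicate n A"] by (metis append.assoc replicate_Suc)
  then show ?case
    by blast
qed

lemma length_image_replicate: "length (f (replicate n A)) = n * length (f [A])"
proof (induction n)
  case (Suc n)
  then show ?case
    using image_Cons[of A "replicate n A"] by simp
qed simp

text \<open>\<open>f x\<close> is a product of \<open>f [A]\<close> and \<open>f [B]\<close>. With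
  \<open>x = f [A]\<close> this makes \<open>f [A]\<close> commute with its own image.\<close>

lemma commute_image:
  assumes "f [A] @ f [B] = f [B] @ f [A]"
  shows "f [A] @ f x = f x @ f [A]"
proof (induction x)
  case (Cons c x)
  have "f [A] @ f [c] = f [c] @ f [A]"
    using assms by (cases c) auto
  then show ?case
    using Cons by (metis append.assoc image_Cons)
qed simp

lemma image_order_if_lyndon:
  assumes lyndon: "\<And>i. 0 < i \<Longrightarrow> \<omega> \<prec>\<^sub>\<omega> sdrop i \<omega>" and aperiodic: "\<not> periodic \<omega>"
  shows "f [A] @ f [B] \<prec> f [B]"
proof (rule ccontr)
  assume not_less: "\<not> f [A] @ f [B] \<prec> f [B]"
  define u v where "u = f [A]" and "v = f [B]"
  have le: "\<not> sdrop i \<omega> \<prec>\<^sub>\<omega> \<omega>" for i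
    using lyndon[of i] inf_less_asym by (cases "i = 0") auto
  have no_commute: "u @ v \<noteq> v @ u"
  proof
    assume "u @ v = v @ u"
    then have "u @ f u = f u @ u"
      using commute_image unfolding u_def v_def by blast
    then show False
      using periodic_if_commute aperiodic image_A unfolding u_def by metis
  qed
  then have "v \<noteq> []"
    by auto
  obtain n where n: "0 < n" "prefix (replicate n A @ [B]) u"
    using first_block[OF aperiodic] unfolding u_def by blast
  have "prefix_of_infword u \<omega>"
    unfolding u_def by (rule omega_prefix_image[OF omega_prefix_A])
  then have block: "prefix_of_infword (replicate n A @ [B]) \<omega>"
    using n(2) prefix_of_infword_prefix by blast
  then have start: "prefix_of_infword (f (replicate n A) @ v) \<omega>"
    using omega_prefix_image image_append unfolding v_def by metis
  have "v \<prec> u @ v"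
    using not_less lex_less_linear[of "u @ v" v] \<open>prefix_of_infword u \<omega>\<close> omega_0
    unfolding u_def v_def by (metis append_self_conv2 image_A list.distinct(1))
  then consider t where "u @ v = v @ t" | x p q where "v = x @ A # p" "u @ v = x @ B # q"
    unfolding lex_less_iff strict_prefix_def prefix_def by blast
  then show False
  proof cases
    case t: 1
    obtain r where "f (replicate n A) @ v = v @ t @ r"
      using image_replicate_shift[of v t n] t n(1) unfolding u_def by blast
    then have vt: "prefix_of_infword (v @ t) \<omega>"
      using start prefix_of_infword_appendD[of "v @ t" r] by simp
    have len: "length u = length t"
      using arg_cong[OF t, of length] by simp
    have "hd v = A"
      using t \<open>v \<noteq> []\<close> image_A unfolding u_def by (metis append_Cons hd_append2 list.sel(1))
    define m where "m = length (f (replicate n A))"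
    have "n < m"
      using n(1) length_image_A unfolding m_def length_image_replicate
      by (metis One_nat_def Suc_1 Suc_le_lessD mult.commute n_less_m_mult_n)
    have "\<omega> !! n = B"
      using block unfolding prefix_of_infword_iff by (metis length_append_singleton length_replicate
          lessI nth_append_length)
    have "\<omega> !! m = A"
      using start \<open>v \<noteq> []\<close> \<open>hd v = A\<close> unfolding prefix_of_infword_iff m_def
      by (auto simp: nth_append hd_conv_nth dest!: spec[of _ "length (f (replicate n A))"])
    \<comment> \<open>Position \<open>n\<close> carries \<open>B\<close> and the later position
      \<open>m\<close>, where \<open>v\<close> starts, carries \<open>A\<close>; without a factor
      \<open>B A\<close> the letter \<open>B\<close> would persist from \<open>n\<close> on.\<close>
    have "\<exists>k. \<omega> !! k = B \<and> \<omega> !! Suc k = A"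
    proof (rule ccontr)
      assume no: "\<nexists>k. \<omega> !! k = B \<and> \<omega> !! Suc k = A"
      have "\<omega> !! k = B" if "n \<le> k" for k
        using that
      proof (induction k rule: dec_induct)
        case (step k)
        then show ?case
          using no by (metis (full_types) letter.exhaust)
      qed (rule \<open>\<omega> !! n = B\<close>)
      then show False
        using \<open>n < m\<close> \<open>\<omega> !! m = A\<close> by (metis less_imp_le letter.distinct(1))
    qed
    then obtain k where k: "\<omega> !! k = B" "\<omega> !! Suc k = A"
      by blast
    have "prefix_of_infword (stake k \<omega> @ [B, A]) \<omega>"
      using k by (simp add: prefix_of_infword_iff nth_append less_Suc_eq nth_Cons')
    then have "prefix_of_infword (f (stake k \<omega>) @ v @ u) \<omega>"
      using omega_prefix_image[of "stake k \<omega> @ [B, A]"] image_Cons[of B "[A]"]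
      by (simp add: image_append u_def v_def)
    then have vu: "prefix_of_infword (v @ u) (sdrop (length (f (stake k \<omega>))) \<omega>)"
      by (rule prefix_of_infword_sdrop)
    \<comment> \<open>\<omega> starts with \<open>v @ t\<close> and contains \<open>v @ u\<close>; a
      smaller \<open>u\<close> would make the suffix starting there smaller than \<omega>.\<close>
    have "\<not> u \<prec> t"
    proof
      assume "u \<prec> t"
      then obtain x p q where x: "u = x @ A # p" "t = x @ B # q"
        using lex_less_long len by (metis order_refl)
      have "prefix_of_infword ((v @ x) @ [B]) \<omega>"
        using vt prefix_of_infword_appendD[of "(v @ x) @ [B]" q] by (simp add: x(2))
      moreover have "prefix_of_infword ((v @ x) @ [A]) (sdrop (length (f (stake k \<omega>))) \<omega>)"
        using vu prefix_of_infword_appendD[of "(v @ x) @ [A]" p] by (simp add: x(1))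
      ultimately show False
        using inf_less_prefix le by blast
    qed
    \<comment> \<open>Now \<open>t\<close> is a factor, at the end of
      \<open>f (replicate n A) @ v\<close>, while \<open>u\<close> is a prefix of \<omega>.\<close>
    moreover have "\<not> t \<prec> u"
    proof
      assume "t \<prec> u"
      then obtain x p q where x: "t = x @ A # p" "u = x @ B # q"
        using lex_less_long len by (metis order_refl)
      obtain n' where n': "n = Suc n'"
        using n(1) gr0_conv_Suc by blast
      have "f (replicate n A) @ v = (f (replicate n' A) @ v) @ t"
        using t image_append[of "replicate n' A" "[A]"]
        unfolding n' replicate_Suc replicate_append_same[symmetric] u_def by simp
      then have "prefix_of_infword t (sdrop (length (f (replicate n' A) @ v)) \<omega>)"
        using start prefix_of_infword_sdrop by metis
      then have "prefix_of_infword (x @ [A]) (sdrop (length (f (replicate n' A) @ v)) \<omega>)"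
        using prefix_of_infword_appendD[of "x @ [A]" p] by (simp add: x(1))
      moreover have "prefix_of_infword (x @ [B]) \<omega>"
        using \<open>prefix_of_infword u \<omega>\<close> prefix_of_infword_appendD[of "x @ [B]" q] by (simp add: x(2))
      ultimately show False
        using inf_less_prefix le by blast
    qed
    ultimately have "u = t"
      using lex_less_linear by blast
    then show False
      using t no_commute by simp
  next
    case x: 2
    obtain z where z: "\<omega> = (f (replicate n A) @ v) @- z"
      using start unfolding prefix_of_infword_def by blast
    define V where "V = v @- z"
    have V: "\<omega> = f (replicate n A) @- V" "sdrop (length (f (replicate n A))) \<omega> = V"
      using z by (simp_all add: V_def sdrop_shift)
    have "prefix_of_infword (x @ [A]) V"
      using prefix_of_infword_appendD[of "x @ [A]" p V] unfolding V_def x(1) prefix_of_infword_def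
      by auto
    moreover have "prefix_of_infword (x @ [B]) (u @- V)"
      using prefix_of_infword_appendD[of "x @ [B]" q "u @- V"] x(2)
      unfolding V_def prefix_of_infword_def by (metis append.assoc append_Cons append_Nil shift_append)
    ultimately have less: "V \<prec>\<^sub>\<omega> u @- V"
      by (rule inf_less_prefix)
    \<comment> \<open>Each further \<open>u\<close> in front increases the word, so the suffix
      \<open>V\<close> falls below \<omega> itself.\<close>
    have "V \<prec>\<^sub>\<omega> f (replicate n A) @- V"
      using n(1)
    proof (induction n rule: nat_induct_non_zero)
      case 1
      then show ?case
        using less by (simp add: u_def)
    next
      case (Suc j)
      have "u @- V \<prec>\<^sub>\<omega> u @- f (replicate j A) @- V"
        using Suc.IH by (rule inf_less_append)
      then show ?case
        using less inf_less_trans image_Cons[of A "replicate j A"] by (metis u_def replicate_Suc shift_append)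
    qed
    then show False
      using V le by metis
  qed
qed

end

subsection \<open>Sufficiency\<close>

locale lyndon_prefix_endomorphism = prolongable_endomorphism +
  fixes l :: word
  assumes preserves: "preserves_lex f"
    and aperiodic: "\<not> periodic \<omega>"
    and lyndon: "lyndon l"
    and prefix_lyndon: "prefix (f (f (f [A]))) l"
begin

abbreviation N :: nat
  where "N \<equiv> length (f (f (f [A])))"

section \<open>Descents within the first \<open>N\<close> letters\<close>

lemma image_ne: "f [B] \<noteq> []"
proof -
  have "[] \<prec> [B]"
    by (simp add: lex_less_iff strict_prefix_def)
  then show ?thesis
    using preserves lex_less_irrefl unfolding preserves_lex_def by (metis image_Nil)
qed

text \<open>Below \<open>N\<close> the words \<omega> and \<open>l\<close> carry the same letters,
  and \<open>l\<close> is Lyndon.\<close>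

lemma no_descent:
  assumes "i + d < N" "\<And>k. k < d \<Longrightarrow> \<omega> !! k = \<omega> !! (i + k)" "\<omega> !! d = B" "\<omega> !! (i + d) = A"
  shows False
proof -
  have "prefix_of_infword (f (f (f [A]))) \<omega>"
    by (intro omega_prefix_image omega_prefix_A)
  then have l: "l ! k = \<omega> !! k" if "k < N" for k
    using that prefix_lyndon unfolding prefix_of_infword_iff by (auto simp: prefix_def nth_append)
  show False
  proof (rule lyndon_nth[OF lyndon])
    show "i + d < length l"
      using assms(1) prefix_length_le[OF prefix_lyndon] by linarith
    show "l ! k = l ! (i + k)" if "k < d" for k
      using l[of k] l[of "i + k"] assms(1) assms(2)[OF that] that by simp
    show "l ! d = B" "l ! (i + d) = A"
      using l[of d] l[of "i + d"] assms(1,3,4) by simp_all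
  qed
qed

lemma no_descending_factor:
  assumes "prefix_of_infword (r @ [B]) \<omega>" "prefix_of_infword (x @ r @ [A]) \<omega>" "length (x @ r) < N"
  shows False
proof (rule no_descent)
  show "length x + length r < N"
    using assms(3) by simp
  show "\<omega> !! length r = B"
    using assms(1) unfolding prefix_of_infword_iff by auto
  show "\<omega> !! (length x + length r) = A"
    using assms(2) unfolding prefix_of_infword_iff by (auto simp: nth_append)
  show "\<omega> !! k = \<omega> !! (length x + k)" if "k < length r" for k
    using assms(1,2) that unfolding prefix_of_infword_iff by (auto simp: nth_append)
qed

text \<open>The first mismatch of \<open>s @ s'\<close> with \<omega> lies beyond \<open>s\<close>.
  If \<open>s @ s'\<close> has \<open>A\<close> there, its occurrence after \<open>x\<close> is a
  descent. If it has \<open>B\<close>, this \<open>B\<close> belongs to the prefix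
  \<open>s'\<close>, and the suffix of \<omega> at \<open>length s\<close> has the descent.\<close>

lemma prefix_append_if_factor:
  assumes s: "prefix_of_infword s \<omega>" "prefix_of_infword s' \<omega>"
    and factor: "prefix_of_infword (x @ s @ s') \<omega>" "length (x @ s @ s') \<le> N"
  shows "prefix_of_infword (s @ s') \<omega>"
proof (rule ccontr)
  assume "\<not> ?thesis"
  then obtain r c t c' where r: "s @ s' = r @ c # t" "prefix_of_infword (r @ [c']) \<omega>" "c \<noteq> c'"
    by (rule prefix_of_infword_mismatch)
  have "length s \<le> length r"
  proof (rule ccontr)
    assume "\<not> ?thesis"
    then have "prefix (r @ [c]) s"
      using r(1) by (metis Suc_leI append.assoc append_Cons append_Nil length_append_singleton
          not_less prefixI prefix_length_prefix)
    then show False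
      using s(1) r(2,3) prefix_of_infword_prefix prefix_of_infword_eq
      by (metis append1_eq_conv length_append_singleton)
  qed
  then obtain r' where r': "r = s @ r'" "s' = r' @ c # t"
    using r(1) by (metis append_eq_append_conv_if append_eq_conv_conj append_take_drop_id)
  show False
  proof (cases c)
    case A
    then have "c' = B"
      using r(3) by (cases c') auto
    moreover have "prefix_of_infword (x @ r @ [A]) \<omega>"
      using factor(1) r(1) A prefix_of_infword_appendD[of "x @ r @ [A]" t] by simp
    ultimately show False
      using no_descending_factor[of r x] r factor(2) by simp
  next
    case B
    then have "c' = A"
      using r(3) by (cases c') auto
    moreover have "prefix_of_infword (r' @ [B]) \<omega>"
      using s(2) r'(2) B prefix_of_infword_appendD[of "r' @ [B]" t] by simp
    ultimately show False
      using no_descending_factor[of r' s] r r' factor(2) by simp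
  qed
qed

section \<open>Suffixes of the image of \<open>B\<close>\<close>

text \<open>The block \<open>replicate n A @ [B]\<close> starts \<open>f [A]\<close>, so its second
  image lies in \<open>f (f (f [A]))\<close>: this is where the third iterate enters. The block is
  smaller than \<open>[B]\<close>, so its image is smaller than \<open>f [B]\<close>, and
  \<open>\<pi>\<close> is what they share before the mismatch.\<close>

lemma image_B_occurs:
  obtains g \<pi> y where "prefix_of_infword (g @ f [B]) \<omega>" "length (g @ f [B]) \<le> N"
    "prefix_of_infword (f g @ f (f [B])) \<omega>" "length (f g @ f (f [B])) \<le> N"
    "f [B] = \<pi> @ B # y" "prefix_of_infword (\<pi> @ [A]) \<omega>"
proof -
  obtain n where n: "0 < n" "prefix (replicate n A @ [B]) (f [A])"
    using first_block[OF aperiodic] by blast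
  define g where "g = f (replicate n A)"
  have gB: "f (replicate n A @ [B]) = g @ f [B]"
    by (simp add: g_def image_append)
  have pre: "prefix (f g @ f (f [B])) (f (f (f [A])))"
    using image_prefix[OF image_prefix[OF n(2)]] by (simp add: g_def image_append)
  have "replicate n A @ [B] \<prec> [B]"
    using n(1) unfolding lex_less_iff by (cases n) auto
  then have "g @ f [B] \<prec> f [B]"
    using preserves gB unfolding preserves_lex_def by metis
  then obtain \<pi> p y where \<pi>: "g @ f [B] = \<pi> @ A # p" "f [B] = \<pi> @ B # y"
    using lex_less_long by (metis length_append le_add2)
  have "prefix_of_infword (replicate n A @ [B]) \<omega>"
    using n(2) omega_prefix_image[OF omega_prefix_A] prefix_of_infword_prefix by blast
  then have "prefix_of_infword (g @ f [B]) \<omega>" "prefix_of_infword (f g @ f (f [B])) \<omega>"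
    using omega_prefix_image image_append gB by metis+
  moreover have "length (f g @ f (f [B])) \<le> N"
    using pre by (rule prefix_length_le)
  moreover have "length (g @ f [B]) \<le> length (f g @ f (f [B]))"
    using length_image_ge[OF image_ne] by (metis add_mono length_append)
  moreover have "prefix_of_infword (\<pi> @ [A]) \<omega>"
    using \<open>prefix_of_infword (g @ f [B]) \<omega>\<close> prefix_of_infword_appendD[of "\<pi> @ [A]" p]
    by (simp add: \<pi>(1))
  ultimately show thesis
    using that \<pi>(2) by (meson order_trans)
qed

text \<open>
  A longest suffix \<open>s\<close> of \<open>f b\<close> that is a prefix of \<open>\<omega>\<close> would be preceded in \<open>f b\<close> by a letter.
  That letter is not \<open>a\<close>, by maximality, and if it is \<open>b\<close> then \<open>s f(s)\<close> is a factor of \<open>f (f b)\<close>,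
  hence a prefix of \<open>\<omega>\<close>.
\<close>

lemma suffix_image_B_not_prefix:
  assumes "f [B] = x @ s" "s \<noteq> []"
  shows "\<not> prefix_of_infword s \<omega>"
proof -
  obtain g \<pi> y where g: "prefix_of_infword (g @ f [B]) \<omega>" "length (g @ f [B]) \<le> N"
    "prefix_of_infword (f g @ f (f [B])) \<omega>" "length (f g @ f (f [B])) \<le> N"
    and \<pi>: "f [B] = \<pi> @ B # y" "prefix_of_infword (\<pi> @ [A]) \<omega>"
    by (rule image_B_occurs)
  show ?thesis
    using assms
  \<comment> \<open>The hypothesis covers the suffix longer by one letter; the base case is
    \<open>f [B]\<close> itself, which leaves \<omega> after \<open>\<pi>\<close>.\<close>
  proof (induction x arbitrary: s rule: rev_induct)
    case Nil
    then have "prefix_of_infword (f [B]) \<omega> \<Longrightarrow> prefix_of_infword (\<pi> @ [B]) \<omega>"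
      using \<pi>(1) prefix_of_infword_appendD[of "\<pi> @ [B]" y] by simp
    then show ?case
      using Nil prefix_of_infword_eq[OF \<pi>(2), of "\<pi> @ [B]"] by auto
  next
    case (snoc c x)
    show ?case
    proof
      assume s: "prefix_of_infword s \<omega>"
      show False
      proof (cases c)
        case A
        have "prefix_of_infword ((g @ x) @ [A] @ s) \<omega>" "length ((g @ x) @ [A] @ s) \<le> N"
          using g(1,2) snoc.prems(1) A by simp_all
        then have "prefix_of_infword ([A] @ s) \<omega>"
          by (rule prefix_append_if_factor[OF omega_prefix_A s])
        then show False
          using snoc.IH[of "[A] @ s"] snoc.prems(1) A by simp
      next
        case B
        \<comment> \<open>The middle letter of \<open>x @ [B] @ s\<close> has this whole word as its
          image, and the ending \<open>s\<close> of that image is followed by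
          \<open>f s\<close>.\<close>
        have "f (f [B]) = f x @ x @ [B] @ s @ f s"
          using snoc.prems(1) B image_append[of "x @ [B]" s] image_append[of x "[B]"] by simp
        then have "prefix_of_infword ((f g @ f x @ x @ [B]) @ s @ f s) \<omega>"
          "length ((f g @ f x @ x @ [B]) @ s @ f s) \<le> N"
          using g(3,4) by simp_all
        then have "prefix_of_infword (s @ f s) \<omega>"
          by (rule prefix_append_if_factor[OF s omega_prefix_image[OF s]])
        then show False
          using periodic_if_prefix[OF image_ne snoc.prems(2)] aperiodic by blast
      qed
    qed
  qed
qed

text \<open>\<open>s\<close> is not a prefix of \<omega>, so it leaves \<omega> at some letter; an
  \<open>A\<close> there would be a descent inside \<open>g @ f [B]\<close>, within the first
  \<open>N\<close> letters.\<close>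

lemma suffix_image_B_greater:
  assumes "f [B] = x @ s" "s \<noteq> []" "prefix_of_infword s z"
  shows "\<omega> \<prec>\<^sub>\<omega> z"
proof -
  obtain g where g: "prefix_of_infword (g @ f [B]) \<omega>" "length (g @ f [B]) \<le> N"
    by (rule image_B_occurs)
  obtain r c t c' where r: "s = r @ c # t" "prefix_of_infword (r @ [c']) \<omega>" "c \<noteq> c'"
    using suffix_image_B_not_prefix[OF assms(1,2)] prefix_of_infword_mismatch by metis
  have "c = B"
  proof (rule ccontr)
    assume "c \<noteq> B"
    then have "c = A" "c' = B"
      using r(3) by (cases c; cases c'; simp)+
    then have "prefix_of_infword ((g @ x) @ r @ [A]) \<omega>"
      using g(1) assms(1) r(1) prefix_of_infword_appendD[of "(g @ x) @ r @ [A]" t] by simp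
    then show False
      using no_descending_factor[of r "g @ x"] r g(2) assms(1) \<open>c' = B\<close> by simp
  qed
  then have "c' = A"
    using r(3) by (cases c') auto
  moreover have "prefix_of_infword (r @ [B]) z"
    using assms(3) r(1) \<open>c = B\<close> prefix_of_infword_appendD[of "r @ [B]" t] by simp
  ultimately show ?thesis
    using r(2) inf_less_prefix by blast
qed

section \<open>Suffixes of the fixed point\<close>

text \<open>A smaller suffix could descend only after the first \<open>N\<close> letters. Until then
  it repeats \<omega>, long enough for the prefix \<open>s\<close> of length \<open>i\<close> to be
  followed by \<open>f s\<close>, which forces periodicity.\<close>

lemma less_sdrop_in_first_image:
  assumes i: "0 < i" "i < length (f [A])"
  shows "\<omega> \<prec>\<^sub>\<omega> sdrop i \<omega>"
proof (rule ccontr)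
  assume "\<not> ?thesis"
  moreover have "sdrop i \<omega> \<noteq> \<omega>"
    using periodic_sdrop[OF i(1)] aperiodic by blast
  ultimately have "sdrop i \<omega> \<prec>\<^sub>\<omega> \<omega>"
    using inf_less_linear by metis
  then obtain d where d: "\<And>k. k < d \<Longrightarrow> \<omega> !! (i + k) = \<omega> !! k" "\<omega> !! (i + d) = A" "\<omega> !! d = B"
    unfolding inf_less_def by (auto simp: sdrop_snth)
  then have "N \<le> i + d"
    using no_descent[of i d] by fastforce
  define s where "s = stake i \<omega>"
  have s: "prefix_of_infword s \<omega>" "length s = i"
    by (simp_all add: s_def prefix_of_infword_stakeI)
  have fA: "prefix_of_infword (f [A]) \<omega>"
    by (rule omega_prefix_image[OF omega_prefix_A])
  have "prefix s (f [A])"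
    using prefix_of_infword_comparable[OF s(1) fA] s(2) i(2) by simp
  then have "length (f s) \<le> length (f (f [A]))"
    by (intro prefix_length_le image_prefix)
  moreover obtain u where u: "f [A] = A # u"
    by (rule image_A)
  moreover have "f (f (f [A])) = f (f [A]) @ f (f u)"
    using u image_append image_Cons by metis
  moreover have "length u \<le> length (f (f u))"
    using length_image_ge[OF image_ne] order_trans by blast
  \<comment> \<open>\<open>N\<close> is the length of \<open>f (f [A])\<close>, which bounds
    \<open>length (f s)\<close>, plus that of \<open>f (f u)\<close>, which is at least
    \<open>length u\<close> and hence at least \<open>i\<close>.\<close>
  ultimately have "i + length (f s) \<le> N"
    using i(2) by simp
  then have "length (f s) \<le> d"
    using \<open>N \<le> i + d\<close> by linarith
  have fs: "prefix_of_infword (f s) \<omega>"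
    by (rule omega_prefix_image[OF s(1)])
  then have "prefix_of_infword (f s) (sdrop i \<omega>)"
    unfolding prefix_of_infword_iff sdrop_snth using d(1) \<open>length (f s) \<le> d\<close> by simp
  then have "prefix_of_infword (s @ f s) \<omega>"
    using s by (intro prefix_of_infword_sdropD) auto
  then show False
    using periodic_if_prefix[OF image_ne, of s] aperiodic s(2) i(1) by auto
qed

text \<open>The mismatch of \<open>r @ [A]\<close> with \<open>r @ [B]\<close> survives under
  \<open>f\<close>, as order preservation separates \<open>f (A # q)\<close> from
  \<open>f [B]\<close>.\<close>

lemma less_sdrop_image:
  assumes "\<omega> \<prec>\<^sub>\<omega> sdrop j \<omega>"
  shows "\<omega> \<prec>\<^sub>\<omega> sdrop (length (f (stake j \<omega>))) \<omega>"
proof -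
  obtain d where d: "\<And>k. k < d \<Longrightarrow> \<omega> !! k = \<omega> !! (j + k)" "\<omega> !! d = A" "\<omega> !! (j + d) = B"
    using assms unfolding inf_less_def by (auto simp: sdrop_snth)
  define r where "r = stake d \<omega>"
  \<comment> \<open>Enough letters to make \<open>f (A # q)\<close> at least as long as
    \<open>f [B]\<close>, so that the two differ at a letter.\<close>
  define q where "q = stake (length (f [B])) (sdrop (Suc d) \<omega>)"
  have "prefix_of_infword (r @ [A]) \<omega>"
    unfolding prefix_of_infword_iff r_def using d(2) by (auto simp: nth_append less_Suc_eq)
  moreover have "prefix_of_infword q (sdrop (length (r @ [A])) \<omega>)"
    by (simp add: q_def r_def prefix_of_infword_stakeI del: sdrop.simps)
  ultimately have "prefix_of_infword ((r @ [A]) @ q) \<omega>"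
    by (rule prefix_of_infword_sdropD)
  then have "prefix_of_infword (r @ A # q) \<omega>"
    by simp
  then have 1: "prefix_of_infword (f r @ f (A # q)) \<omega>"
    using omega_prefix_image image_append by metis
  have "prefix_of_infword (r @ [B]) (sdrop (length (stake j \<omega>)) \<omega>)"
    unfolding prefix_of_infword_iff r_def using d(1)[symmetric] d(3)
    by (auto simp: nth_append less_Suc_eq sdrop_snth)
  then have "prefix_of_infword (stake j \<omega> @ r @ [B]) \<omega>"
    by (rule prefix_of_infword_sdropD[OF prefix_of_infword_stakeI])
  then have "prefix_of_infword (f (stake j \<omega>) @ f r @ f [B]) \<omega>"
    using omega_prefix_image image_append by metis
  then have 2: "prefix_of_infword (f r @ f [B]) (sdrop (length (f (stake j \<omega>))) \<omega>)"
    by (rule prefix_of_infword_sdrop)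
  have "A # q \<prec> [B]"
    by (auto simp: lex_less_iff)
  then have "f (A # q) \<prec> f [B]"
    using preserves unfolding preserves_lex_def by blast
  moreover have "length (f [B]) \<le> length (f (A # q))"
    using length_image_ge[OF image_ne, of "A # q"] by (simp add: q_def)
  ultimately obtain x p t where x: "f (A # q) = x @ A # p" "f [B] = x @ B # t"
    by (rule lex_less_long)
  have "prefix_of_infword ((f r @ x) @ [A]) \<omega>"
    using 1 x(1) prefix_of_infword_appendD[of "(f r @ x) @ [A]" p] by simp
  moreover have "prefix_of_infword ((f r @ x) @ [B]) (sdrop (length (f (stake j \<omega>))) \<omega>)"
    using 2 x(2) prefix_of_infword_appendD[of "(f r @ x) @ [B]" t] by simp
  ultimately show ?thesis
    by (rule inf_less_prefix)
qed

lemma locate_in_image: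
  obtains j k where "i = length (f (stake j \<omega>)) + k" "k < length (f [\<omega> !! j])"
proof -
  have ne: "0 < length (f [c])" for c
    using length_image_ge[OF image_ne, of "[c]"] by (simp add: Suc_le_eq)
  have step: "length (f (stake (Suc j) \<omega>)) = length (f (stake j \<omega>)) + length (f [\<omega> !! j])" for j
    by (simp add: stake_Suc image_append del: stake.simps)
  have "\<exists>j k. i = length (f (stake j \<omega>)) + k \<and> k < length (f [\<omega> !! j])"
  proof (induction i)
    case 0
    show ?case
      using ne by (intro exI[of _ 0]) auto
  next
    case (Suc i)
    then obtain j k where jk: "i = length (f (stake j \<omega>)) + k" "k < length (f [\<omega> !! j])"
      by blast
    show ?case
    proof (cases "Suc k < length (f [\<omega> !! j])")
      case True
      then show ?thesis
        using jk by (intro exI[of _ j] exI[of _ "Suc k"]) simp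
    next
      case False
      then show ?thesis
        using jk step[of j] ne by (intro exI[of _ "Suc j"] exI[of _ 0]) (simp del: stake.simps)
    qed
  qed
  then show thesis
    using that by blast
qed

text \<open>Position \<open>i\<close> lies in the image of the letter at \<open>j\<close>. For
  \<open>B\<close> the suffix starts with an ending of \<open>f [B]\<close>. For \<open>A\<close>
  with \<open>j > 0\<close> the induction hypothesis at \<open>j\<close> is carried by
  \<open>f\<close> to the start \<open>J\<close> of that image and then shifted by
  \<open>k\<close>.\<close>

lemma less_sdrop: "0 < i \<Longrightarrow> \<omega> \<prec>\<^sub>\<omega> sdrop i \<omega>"
proof (induction i rule: less_induct)
  case (less i)
  obtain j k where jk: "i = length (f (stake j \<omega>)) + k" "k < length (f [\<omega> !! j])"
    by (rule locate_in_image)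
  define J where "J = length (f (stake j \<omega>))"
  have "prefix_of_infword (stake j \<omega> @ [\<omega> !! j]) \<omega>"
    by (simp add: prefix_of_infword_iff nth_append less_Suc_eq)
  then have "prefix_of_infword (f (stake j \<omega>) @ f [\<omega> !! j]) \<omega>"
    using omega_prefix_image image_append by metis
  then have at_J: "prefix_of_infword (f [\<omega> !! j]) (sdrop J \<omega>)"
    unfolding J_def by (rule prefix_of_infword_sdrop)
  have drop_k: "sdrop i \<omega> = sdrop k (sdrop J \<omega>)"
    using jk(1) by (simp add: J_def sdrop_add)
  show ?case
  proof (cases "\<omega> !! j")
    case B
    have "prefix_of_infword (drop k (f [B])) (sdrop i \<omega>)"
      using at_J B unfolding prefix_of_infword_iff drop_k by (simp add: sdrop_snth add.assoc)
    then show ?thesis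
      using suffix_image_B_greater[of "take k (f [B])" "drop k (f [B])"] jk(2) B by simp
  next
    case A
    show ?thesis
    proof (cases "j = 0")
      case True
      then show ?thesis
        using less_sdrop_in_first_image[of i] less.prems jk A by simp
    next
      case False
      \<comment> \<open>This yields \<open>j < i\<close>: no image is empty, and the image of the
        first letter \<open>A\<close> has at least two letters.\<close>
      have "j < length (f (stake j \<omega>))"
      proof -
        have "stake j \<omega> = A # stake (j - 1) (stl \<omega>)"
          using False omega_0 by (cases j) auto
        then show ?thesis
          using length_image_A length_image_ge[OF image_ne, of "stake (j - 1) (stl \<omega>)"]
            image_Cons[of A "stake (j - 1) (stl \<omega>)"] False by simp
      qed
      then have "\<omega> \<prec>\<^sub>\<omega> sdrop j \<omega>"
        using less.IH[of j] False jk(1) by simp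
      then have less_J: "\<omega> \<prec>\<^sub>\<omega> sdrop J \<omega>"
        unfolding J_def by (rule less_sdrop_image)
      show ?thesis
      proof (cases "k = 0")
        case True
        then show ?thesis
          using less_J drop_k by simp
      next
        case False
        obtain d where d: "\<forall>m<d. \<omega> !! m = sdrop J \<omega> !! m" "\<omega> !! d = A" "sdrop J \<omega> !! d = B"
          using less_J unfolding inf_less_def by blast
        \<comment> \<open>Both words start with \<open>f [A]\<close>, so their mismatch survives
          dropping \<open>k\<close> letters, and \<open>sdrop k \<omega>\<close> starts inside the
          first image.\<close>
        have "\<omega> !! m = sdrop J \<omega> !! m" if "m < length (f [A])" for m
          using that at_J A omega_prefix_image[OF omega_prefix_A] unfolding prefix_of_infword_iff
          by simp
        then have "k \<le> d"
          using d(2,3) jk(2) A by (metis letter.distinct(1) less_imp_le less_trans not_less)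
        then have "sdrop k \<omega> \<prec>\<^sub>\<omega> sdrop k (sdrop J \<omega>)"
          using d unfolding inf_less_def by (intro exI[of _ "d - k"]) (auto simp: sdrop_snth add.assoc)
        moreover have "\<omega> \<prec>\<^sub>\<omega> sdrop k \<omega>"
          using less_sdrop_in_first_image[of k] False jk(2) A by simp
        ultimately show ?thesis
          using inf_less_trans drop_k by metis
      qed
    qed
  qed
qed

end

theorem theorem2:
  fixes f :: "word \<Rightarrow> word"
  assumes "endomorphism f"
    and "prolongable f A"
  shows "infinite_lyndon (omega_iterate f A) \<longleftrightarrow>
    preserves_lex f \<and>
    \<not> periodic (omega_iterate f A) \<and>
    (\<exists>l. lyndon l \<and> prefix ((f ^^ 3) [A]) l)"
proof -
  interpret prolongable_endomorphism f
    using assms by unfold_locales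
  have f3: "(f ^^ 3) [A] = f (f (f [A]))"
    by (simp add: numeral_3_eq_3)
  show ?thesis
  proof (intro iffI conjI)
    assume L: "infinite_lyndon \<omega>"
    have less: "\<omega> \<prec>\<^sub>\<omega> sdrop i \<omega>" if "0 < i" for i
      using infinite_lyndonD[OF L that] .
    show aperiodic: "\<not> periodic \<omega>"
    proof
      assume "periodic \<omega>"
      then obtain u where u: "u \<noteq> []" "\<omega> = cycle u"
        unfolding periodic_def by blast
      then have "sdrop (length u) \<omega> = \<omega>"
        using cycle_decomp[OF u(1)] by (simp add: sdrop_shift)
      then show False
        using less[of "length u"] u(1) inf_less_asym by fastforce
    qed
    show "preserves_lex f"
      by (intro preserves_lexI image_order_if_lyndon less aperiodic)
    obtain n where n: "length ((f ^^ 3) [A]) < n" "lyndon (stake n \<omega>)"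
      using L unfolding infinite_lyndon_def infinite_prefixes_iff by blast
    have "prefix ((f ^^ 3) [A]) (stake n \<omega>)"
      using prefix_of_infword_comparable[OF prefix_omega_iterate[OF assms, of 3]
          prefix_of_infword_stakeI[of n]] n(1) by simp
    then show "\<exists>l. lyndon l \<and> prefix ((f ^^ 3) [A]) l"
      using n(2) by blast
  next
    assume R: "preserves_lex f \<and> \<not> periodic \<omega> \<and> (\<exists>l. lyndon l \<and> prefix ((f ^^ 3) [A]) l)"
    then obtain l where "lyndon l" "prefix (f (f (f [A]))) l"
      unfolding f3 by blast
    with R interpret lyndon_prefix_endomorphism f l
      by unfold_locales auto
    show "infinite_lyndon \<omega>"
      by (intro infinite_lyndonI less_sdrop)
  qed
qed

end
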